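(* Let $B=\{b_k(x)\}_{k=0}^\infty$ and $Q=\{q_k(x)\}_{k=0}^\infty$ be simple sets of polynomials. If there exists a real number $\alpha>1$ such that both $\{\alpha^k\}_{k=0}^\infty$ and $\{(1/\alpha)^k\}_{k=0}^\infty$ are $B$-multiplier sequences, then every $Q$-multiplier sequence is also a $B$-multiplier sequence.
   Context: All polynomials have real coefficients. A simple set of polynomials is a sequence $Q=\{q_k(x)\}_{k=0}^\infty$ of real polynomials with $\deg q_k=k$ for $k=0,1,2,\ldots$ (so $q_0$ is a nonzero constant, and $Q$ is a basis of $\mathbb{R}[x]$). A polynomial "has only real zeros" if it has no non-real complex zeros or is identically zero (nonzero constants also qualify). A sequence of real numbers $\{\gamma_k\}_{k=0}^\infty$ is a $Q$-multiplier sequence if, for every $n$ and all real $a_0,\ldots,a_n$, the polynomial $\sum_{k=0}^n a_k\gamma_k q_k(x)$ has only real zeros whenever $\sum_{k=0}^n a_k q_k(x)$ has only real zeros. *)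

theory Defs
  imports "HOL-Analysis.Analysis" "HOL-Computational_Algebra.Polynomial"
begin

(* Excluding the zero polynomial matters only for k = 0, since degree 0 = 0. *)
definition simple_set :: "(nat \<Rightarrow> real poly) \<Rightarrow> bool" where
  "simple_set q \<longleftrightarrow> (\<forall>k. q k \<noteq> 0 \<and> degree (q k) = k)"

definition only_real_zeros :: "real poly \<Rightarrow> bool" where
  "only_real_zeros p \<longleftrightarrow>
     p = 0 \<or> (\<forall>z::complex. poly (map_poly complex_of_real p) z = 0 \<longrightarrow> z \<in> \<real>)"

definition multiplier_sequence :: "(nat \<Rightarrow> real poly) \<Rightarrow> (nat \<Rightarrow> real) \<Rightarrow> bool" where
  "multiplier_sequence q \<gamma> \<longleftrightarrow>
     (\<forall>(n::nat) (a::nat \<Rightarrow> real).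
        only_real_zeros (\<Sum>k\<le>n. smult (a k) (q k)) \<longrightarrow>
        only_real_zeros (\<Sum>k\<le>n. smult (a k * \<gamma> k) (q k)))"

end

theory Submission
  imports Defs "HOL-Computational_Algebra.Fundamental_Theorem_Algebra"
begin

text \<open>
The hypothesis on \<open>B\<close> is very restrictive: it forces \<open>b\<^sub>k = c\<^sub>k (x - x\<^sub>0)\<^sup>k\<close>. Since rescaling the
basis and translating the variable do not change which sequences are multiplier sequences, the
claim then reduces to the fact that every \<open>Q\<close>-multiplier sequence is a multiplier sequence for the
monomials.

\<^emph>\<open>Rigidity of B.\<close> Normalise \<open>B\<close> to be monic with \<open>b\<^sub>1 = x\<close>. For \<open>n \<ge> 2\<close> let \<open>b\<^sub>n = x\<^sup>n + e\<close> with \<open>b\<^sub>j = x\<^sup>j\<close> for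
\<open>j < n\<close>. The operator with \<open>b\<^sub>k \<mapsto> \<beta>\<^sup>k b\<^sub>k\<close> differs from the dilation \<open>p(x) \<mapsto> p(\<beta>x)\<close> only in degree \<open>n\<close>, so
it sends \<open>(x - s\<beta>)\<^sup>n\<close> to \<open>\<beta>\<^sup>n ((x - s)\<^sup>n + G)\<close>, where \<open>G\<close> has degree below \<open>n\<close>, does not depend
on \<open>s\<close>, and has coefficients \<open>G\<^sub>j = e\<^sub>j (1 - \<beta>\<^sup>j\<^sup>-\<^sup>n)\<close>. If \<open>x\<^sub>1, \<dots>, x\<^sub>n\<close> are the
zeros of \<open>(x - s)\<^sup>n + G\<close>, then with \<open>g\<^sub>1 = G\<^sub>n\<^sub>-\<^sub>1\<close> and \<open>g\<^sub>2 = G\<^sub>n\<^sub>-\<^sub>2\<close>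

  \<open>\<Sum> (x\<^sub>i - s)\<^sup>2 = g\<^sub>1\<^sup>2 - 2 g\<^sub>2 - 2 (n - 1) s g\<^sub>1\<close>,

which must be nonnegative for every real \<open>s\<close>. Hence \<open>g\<^sub>1 = 0\<close> and \<open>g\<^sub>2 \<le> 0\<close>, and \<open>g\<^sub>2 = 0\<close> is possible
only if \<open>G = 0\<close> (\<open>perturbed_powers\<close>). The factor \<open>1 - \<beta>\<^sup>-\<^sup>2\<close> has opposite signs for
\<open>\<beta> = \<alpha>\<close> and \<open>\<beta> = 1/\<alpha>\<close>, so using both sequences gives \<open>e\<^sub>n\<^sub>-\<^sub>2 = 0\<close>, thus \<open>G = 0\<close> and
\<open>e = 0\<close> (\<open>dilations_force_powers\<close>).

\<^emph>\<open>From Q to monomials.\<close> The operator with \<open>q\<^sub>k \<mapsto> \<gamma>\<^sub>k q\<^sub>k\<close> is triangular on monomials, with diagonal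
\<open>\<gamma>\<^sub>k\<close>. Conjugating it with the dilation by \<open>\<epsilon>\<close> preserves real-rootedness and multiplies the entries
below the diagonal by positive powers of \<open>\<epsilon>\<close>, so for \<open>\<epsilon> \<rightarrow> 0\<close> only the diagonal operator remains
(\<open>multiplier_sequence_monom\<close>). Real-rootedness survives the limit (\<open>only_real_zeros_limit\<close>).
\<close>


section \<open>Evaluating real polynomials at complex points\<close>

lemma poly_of_real_add:
  "poly (map_poly complex_of_real (p + q)) z
     = poly (map_poly of_real p) z + poly (map_poly of_real q) z"
  by (induction p q rule: poly_induct2) (auto simp: map_poly_pCons algebra_simps)

lemma poly_of_real_smult:
  "poly (map_poly complex_of_real (smult c p)) z = of_real c * poly (map_poly of_real p) z"
  by (simp add: map_poly_smult)

lemma poly_of_real_mult: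
  "poly (map_poly complex_of_real (p * q)) z
     = poly (map_poly of_real p) z * poly (map_poly of_real q) z"
  by (induction p)
     (auto simp: map_poly_pCons poly_of_real_add poly_of_real_smult algebra_simps)

lemma poly_of_real_power:
  "poly (map_poly complex_of_real (p ^ n)) z = poly (map_poly of_real p) z ^ n"
  by (induction n) (auto simp: poly_of_real_mult)

lemma poly_of_real_sum:
  "poly (map_poly complex_of_real (\<Sum>i\<in>A. f i)) z = (\<Sum>i\<in>A. poly (map_poly of_real (f i)) z)"
  by (induction A rule: infinite_finite_induct) (auto simp: poly_of_real_add)

lemma poly_of_real_pcompose:
  "poly (map_poly complex_of_real (p \<circ>\<^sub>p q)) z
     = poly (map_poly of_real p) (poly (map_poly of_real q) z)"
  by (induction p)
     (auto simp: map_poly_pCons pcompose_pCons poly_of_real_add poly_of_real_mult)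

lemma poly_of_real_of_real:
  "poly (map_poly complex_of_real p) (of_real x) = of_real (poly p x)"
  by (induction p) (auto simp: map_poly_pCons)

section \<open>Polynomials with only real zeros\<close>

lemma only_real_zerosD:
  "only_real_zeros p \<Longrightarrow> p \<noteq> 0 \<Longrightarrow> poly (map_poly complex_of_real p) z = 0 \<Longrightarrow> z \<in> \<real>"
  by (auto simp: only_real_zeros_def)

lemma only_real_zeros_smult:
  "only_real_zeros p \<Longrightarrow> only_real_zeros (smult c p)"
  by (cases "c = 0") (auto simp: only_real_zeros_def poly_of_real_smult)

lemma only_real_zeros_pcompose_affine:
  assumes "only_real_zeros p" "t \<noteq> 0"
  shows   "only_real_zeros (p \<circ>\<^sub>p [:s, t:])"
proof (cases "p = 0")
  case False
  have "z \<in> \<real>" if "poly (map_poly complex_of_real (p \<circ>\<^sub>p [:s, t:])) z = 0" for z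
  proof -
    have "poly (map_poly complex_of_real p) (of_real s + z * of_real t) = 0"
      using that by (simp add: poly_of_real_pcompose map_poly_pCons)
    hence "of_real s + z * of_real t \<in> \<real>"
      using only_real_zerosD[OF assms(1) False] by blast
    hence "(of_real s + z * of_real t - of_real s) / of_real t \<in> \<real>"
      by (intro Reals_divide Reals_diff Reals_of_real)
    thus ?thesis using assms(2) by simp
  qed
  thus ?thesis by (auto simp: only_real_zeros_def)
qed (auto simp: only_real_zeros_def)

lemma only_real_zeros_splits:
  assumes "only_real_zeros p" "p \<noteq> 0"
  shows   "\<exists>rs. p = smult (lead_coeff p) (\<Prod>r\<leftarrow>rs. [:-r, 1:])"
  using assms
proof (induction "degree p" arbitrary: p)
  case 0
  then obtain c where "p = [:c:]" by (metis degree_eq_zeroE)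
  thus ?case by (intro exI[of _ "[]"]) auto
next
  case (Suc n)
  have "degree (map_poly complex_of_real p) = Suc n"
    using Suc.hyps by (simp add: degree_map_poly)
  hence "\<not> constant (poly (map_poly complex_of_real p))"
    by (simp add: constant_degree)
  then obtain z where z: "poly (map_poly complex_of_real p) z = 0"
    using fundamental_theorem_of_algebra by blast
  then obtain r where r: "z = of_real r"
    using only_real_zerosD[OF Suc.prems] by (auto elim!: Reals_cases)
  have "poly p r = 0" using z by (simp add: r poly_of_real_of_real)
  then obtain p' where p': "p = [:-r, 1:] * p'"
    by (auto simp: poly_eq_0_iff_dvd dvd_def)
  have nz: "p' \<noteq> 0" using p' Suc.prems by auto
  have "degree p = Suc (degree p')"
    unfolding p' using nz by (subst degree_mult_eq) auto
  moreover have "only_real_zeros p'"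
    using Suc.prems by (auto simp: only_real_zeros_def p' poly_of_real_mult simp del: mult_pCons_left)
  ultimately obtain rs where rs: "p' = smult (lead_coeff p') (\<Prod>r\<leftarrow>rs. [:-r, 1:])"
    using Suc.hyps(1)[of p'] Suc.hyps(2) nz by auto
  have "lead_coeff p = lead_coeff p'"
    unfolding p' lead_coeff_mult by simp
  moreover have "p = smult (lead_coeff p') (\<Prod>r\<leftarrow>r # rs. [:-r, 1:])"
    by (subst p', subst rs) simp
  ultimately show ?case by metis
qed

text \<open>
Each factor satisfies \<open>\<bar>x + iy - r\<bar>\<^sup>2 = (x - r)\<^sup>2 + y\<^sup>2\<close>, which grows with \<open>\<bar>y\<bar>\<close>.
\<close>
lemma norm_poly_mono_Im:
  assumes "only_real_zeros p" "Re w = Re z" "\<bar>Im w\<bar> \<le> \<bar>Im z\<bar>"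
  shows   "norm (poly (map_poly complex_of_real p) w) \<le> norm (poly (map_poly complex_of_real p) z)"
proof (cases "p = 0")
  case False
  then obtain rs where rs: "p = smult (lead_coeff p) (\<Prod>r\<leftarrow>rs. [:-r, 1:])"
    using only_real_zeros_splits assms(1) by blast
  have fac: "norm (w - of_real r) \<le> norm (z - of_real r)" for r
    using assms(2,3) by (auto simp: cmod_def abs_le_square_iff)
  have "norm (poly (map_poly complex_of_real (\<Prod>r\<leftarrow>rs. [:-r, 1:])) w)
          \<le> norm (poly (map_poly complex_of_real (\<Prod>r\<leftarrow>rs. [:-r, 1:])) z)"
  proof (induction rs)
    case (Cons r rs)
    have "norm (w - of_real r) * norm (poly (map_poly complex_of_real (\<Prod>r\<leftarrow>rs. [:-r, 1:])) w)
          \<le> norm (z - of_real r) * norm (poly (map_poly complex_of_real (\<Prod>r\<leftarrow>rs. [:-r, 1:])) z)"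
      by (intro mult_mono fac Cons.IH) auto
    thus ?case
      by (simp add: poly_of_real_mult map_poly_pCons norm_mult del: mult_pCons_left)
  qed auto
  hence "norm (poly (map_poly complex_of_real (smult (lead_coeff p) (\<Prod>r\<leftarrow>rs. [:-r, 1:]))) w)
          \<le> norm (poly (map_poly complex_of_real (smult (lead_coeff p) (\<Prod>r\<leftarrow>rs. [:-r, 1:]))) z)"
    by (simp add: poly_of_real_smult norm_mult mult_left_mono)
  thus ?thesis using rs by metis
qed auto

text \<open>
The vertical monotonicity of the modulus passes to the limit. A non-real zero of the limit would
therefore force infinitely many zeros: the whole vertical segment from the real axis to that zero
or its conjugate, whichever lies in the upper half plane.
\<close>
lemma only_real_zeros_limit:
  fixes F :: "nat \<Rightarrow> real poly"
  assumes real: "\<And>m. only_real_zeros (F m)"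
    and lim: "\<And>z. (\<lambda>m. poly (map_poly complex_of_real (F m)) z)
                     \<longlonglongrightarrow> poly (map_poly complex_of_real p) z"
  shows "only_real_zeros p"
proof (rule ccontr)
  assume "\<not> only_real_zeros p"
  then obtain z where nz: "p \<noteq> 0" and z: "poly (map_poly complex_of_real p) z = 0" "z \<notin> \<real>"
    by (auto simp: only_real_zeros_def)
  have "poly (map_poly complex_of_real p) (Complex (Re z) y) = 0" if "y \<in> {0..\<bar>Im z\<bar>}" for y
  proof -
    have "norm (poly (map_poly complex_of_real p) (Complex (Re z) y))
            \<le> norm (poly (map_poly complex_of_real p) z)"
      using that
      by (intro LIMSEQ_le[OF tendsto_norm[OF lim] tendsto_norm[OF lim]] exI allI impI
            norm_poly_mono_Im real) auto
    thus ?thesis using z by simp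
  qed
  hence "Complex (Re z) ` {0..\<bar>Im z\<bar>} \<subseteq> {w. poly (map_poly complex_of_real p) w = 0}"
    by auto
  moreover have "map_poly complex_of_real p \<noteq> 0"
    using nz by (simp add: map_poly_eq_0_iff)
  ultimately have "finite (Complex (Re z) ` {0..\<bar>Im z\<bar>})"
    using poly_roots_finite finite_subset by blast
  hence "finite {0..\<bar>Im z\<bar>}"
    by (rule finite_imageD) (auto simp: inj_on_def)
  thus False
    using z(2) by (simp add: infinite_Icc complex_is_Real_iff)
qed

section \<open>Translated powers with a fixed perturbation\<close>

text \<open>
The two leading nontrivial coefficients are elementary symmetric functions of the zeros; the
second is expressed through \<open>2 e\<^sub>2 = (\<Sum> r)\<^sup>2 - \<Sum> r\<^sup>2\<close>, the form in which it enters sums of squares.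
\<close>
lemma prod_linear_coeffs:
  fixes rs :: "real list"
  defines "P \<equiv> (\<Prod>r\<leftarrow>rs. [:-r, 1:])"
  shows degree_prod_linear: "degree P = length rs"
    and coeff_prod_linear_top: "coeff P (length rs) = 1"
    and coeff_prod_linear_1: "length rs = Suc m \<Longrightarrow> coeff P m = - sum_list rs"
    and coeff_prod_linear_2: "length rs = Suc (Suc m) \<Longrightarrow>
           2 * coeff P m = (sum_list rs)\<^sup>2 - (\<Sum>r\<leftarrow>rs. r\<^sup>2)"
proof -
  have "degree (\<Prod>r\<leftarrow>rs. [:-r, 1:]) = length rs
      \<and> coeff (\<Prod>r\<leftarrow>rs. [:-r, 1:]) (length rs) = 1" for rs :: "real list"
  proof (induction rs)
    case (Cons r rs)
    have nz: "(\<Prod>r\<leftarrow>rs. [:-r, 1:]) \<noteq> 0" using Cons.IH by auto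
    have "degree ([:-r, 1:] * (\<Prod>r\<leftarrow>rs. [:-r, 1:])) = length (r # rs)"
      using nz Cons.IH by (subst degree_mult_eq) auto
    thus ?case using Cons.IH by (simp add: coeff_eq_0)
  qed auto
  note top = this
  thus "degree P = length rs" "coeff P (length rs) = 1" by (auto simp: P_def)
  have one: "coeff (\<Prod>r\<leftarrow>rs. [:-r, 1:]) m = - sum_list rs" if "length rs = Suc m" for m and rs :: "real list"
    using that
  proof (induction rs arbitrary: m)
    case (Cons r rs)
    thus ?case using top[of rs] by (cases m) auto
  qed auto
  thus "length rs = Suc m \<Longrightarrow> coeff P m = - sum_list rs" by (simp add: P_def)
  have "2 * coeff (\<Prod>r\<leftarrow>rs. [:-r, 1:]) m = (sum_list rs)\<^sup>2 - (\<Sum>r\<leftarrow>rs. r\<^sup>2)"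
    if "length rs = Suc (Suc m)" for m and rs :: "real list"
    using that
  proof (induction rs arbitrary: m)
    case (Cons r rs)
    show ?case
    proof (cases m)
      case 0
      then obtain s where "rs = [s]" using Cons.prems by (auto simp: length_Suc_conv)
      thus ?thesis using 0 by (simp add: power2_eq_square algebra_simps)
    next
      case (Suc k)
      thus ?thesis using Cons one[of rs m]
        by (simp add: power2_eq_square algebra_simps)
    qed
  qed auto
  thus "length rs = Suc (Suc m) \<Longrightarrow> 2 * coeff P m = (sum_list rs)\<^sup>2 - (\<Sum>r\<leftarrow>rs. r\<^sup>2)"
    by (simp add: P_def)
qed

lemma sum_list_squares_shift:
  fixes rs :: "real list"
  shows "(\<Sum>x\<leftarrow>rs. (x - r)\<^sup>2) = (\<Sum>x\<leftarrow>rs. x\<^sup>2) - 2 * r * sum_list rs + real (length rs) * r\<^sup>2"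
  by (induction rs) (auto simp: power2_eq_square algebra_simps)

text \<open>
The sum of \<open>(x\<^sub>i - r)\<^sup>2\<close> over the zeros \<open>x\<^sub>i\<close> of \<open>(x - r)\<^sup>n + G\<close> is affine in \<open>r\<close>, because the quadratic
terms cancel. As a sum of squares of reals it is nonnegative for all \<open>r\<close>, so the slope vanishes;
and if the constant vanishes too, then at \<open>r = 0\<close> all zeros are \<open>0\<close>.
\<close>
lemma perturbed_powers:
  fixes G :: "real poly"
  assumes deg: "degree G < Suc (Suc m)"
    and real: "\<And>r. only_real_zeros ([:-r, 1:] ^ Suc (Suc m) + G)"
  shows "coeff G m \<le> 0" and "coeff G m = 0 \<Longrightarrow> G = 0"
proof -
  define n where "n = Suc (Suc m)"
  define g1 where "g1 = coeff G (Suc m)"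
  define g2 where "g2 = coeff G m"
  have roots: "\<exists>rs. [:-r, 1:] ^ n + G = (\<Prod>x\<leftarrow>rs. [:-x, 1:]) \<and> length rs = n
      \<and> (\<Sum>x\<leftarrow>rs. (x - r)\<^sup>2) = g1\<^sup>2 - 2 * g2 - 2 * (real n - 1) * r * g1" for r
  proof -
    let ?p = "[:-r, 1:] ^ n + G"
    have repl: "[:-r, 1:] ^ n = (\<Prod>x\<leftarrow>replicate n r. [:-x, 1:])"
      by simp
    have deg_p: "degree ?p = n"
      using deg degree_linear_power[of "-r" n]
      by (subst degree_add_eq_left) (simp_all only: n_def)
    have "coeff ?p n = 1"
      using deg[folded n_def] by (simp add: coeff_linear_power coeff_eq_0)
    hence lead: "lead_coeff ?p = 1" by (simp only: deg_p)
    hence "?p \<noteq> 0" by (metis leading_coeff_0_iff zero_neq_one)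
    then obtain rs where rs: "?p = (\<Prod>x\<leftarrow>rs. [:-x, 1:])"
      using only_real_zeros_splits[of ?p] real[of r] lead by (auto simp: n_def)
    have len: "length rs = n"
      using deg_p degree_prod_linear[of rs] by (simp only: rs)
    have "- sum_list rs = - (real n * r) + g1"
    proof -
      have "coeff ([:-r, 1:] ^ n) (Suc m) = - (real n * r)"
        unfolding repl by (subst coeff_prod_linear_1) (auto simp: n_def sum_list_replicate algebra_simps)
      moreover have "coeff ?p (Suc m) = - sum_list rs"
        unfolding rs using len by (intro coeff_prod_linear_1) (simp add: n_def)
      ultimately show ?thesis by (simp add: g1_def)
    qed
    hence s1: "sum_list rs = real n * r - g1" by simp
    have s2: "(sum_list rs)\<^sup>2 - (\<Sum>x\<leftarrow>rs. x\<^sup>2) = (real n * r)\<^sup>2 - real n * r\<^sup>2 + 2 * g2"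
    proof -
      have "2 * coeff ([:-r, 1:] ^ n) m = (real n * r)\<^sup>2 - real n * r\<^sup>2"
        unfolding repl by (subst coeff_prod_linear_2) (auto simp: n_def sum_list_replicate algebra_simps)
      moreover have "2 * coeff ?p m = (sum_list rs)\<^sup>2 - (\<Sum>x\<leftarrow>rs. x\<^sup>2)"
        unfolding rs using len by (intro coeff_prod_linear_2) (simp add: n_def)
      ultimately show ?thesis by (simp add: g2_def)
    qed
    have "(\<Sum>x\<leftarrow>rs. (x - r)\<^sup>2) = g1\<^sup>2 - 2 * g2 - 2 * (real n - 1) * r * g1"
      using s2 unfolding sum_list_squares_shift s1 len
      by (simp add: power2_eq_square algebra_simps)
    thus ?thesis using rs len by blast
  qed
  have ineq: "0 \<le> g1\<^sup>2 - 2 * g2 - 2 * (real n - 1) * r * g1" for r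
  proof -
    have "0 \<le> (\<Sum>x\<leftarrow>rs. (x - r)\<^sup>2)" for rs :: "real list"
      by (intro sum_list_nonneg) auto
    thus ?thesis using roots[of r] by metis
  qed
  have g1: "g1 = 0"
  proof (rule ccontr)
    assume "g1 \<noteq> 0"
    \<comment> \<open>This value of \<open>r\<close> makes the affine function equal to \<open>-1\<close>.\<close>
    thus False
      using ineq[of "(g1\<^sup>2 - 2 * g2 + 1) / (2 * (real n - 1) * g1)"]
      by (simp add: n_def)
  qed
  show "coeff G m \<le> 0" using ineq[of 0] g1 by (simp add: g2_def)
  show "G = 0" if zero: "coeff G m = 0"
  proof -
    from roots[of 0] obtain rs where rs: "[:0, 1:] ^ n + G = (\<Prod>x\<leftarrow>rs. [:-x, 1:])"
      "length rs = n" "(\<Sum>x\<leftarrow>rs. x\<^sup>2) = 0"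
      using g1 zero by (auto simp: g2_def)
    have "\<forall>x\<in>set rs. x = 0"
      using rs(3) by (subst (asm) sum_list_nonneg_eq_0_iff) auto
    hence "rs = replicate n 0" using rs(2) by (simp add: replicate_eqI)
    thus ?thesis using rs(1) by simp
  qed
qed


section \<open>Rigidity of bases that admit dilations\<close>

lemma smult_sum_right:
  "smult c (\<Sum>i\<in>A. f i) = (\<Sum>i\<in>A. smult c (f i))"
  by (induction A rule: infinite_finite_induct) (auto simp: smult_add_right)

lemma coeff_sum_monom_lessThan:
  "coeff (\<Sum>k<n. monom (f k) k) i = (if i < n then f i else 0)"
  by (simp add: coeff_sum)

text \<open>
In the induction step all lower basis elements are monomials, and \<open>e = b\<^sub>n - x\<^sup>n\<close> has to vanish.
The polynomial \<open>e\<close> enters the image of \<open>(x - s\<beta>)\<^sup>n\<close> only through a term \<open>G\<close> that is independent of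
\<open>s\<close>, which is what the preceding lemma requires. The bounds it yields for \<open>\<alpha>\<close> and \<open>1/\<alpha>\<close> have
opposite directions, and this is where both sequences are needed.
\<close>
lemma dilations_force_powers:
  assumes deg: "\<And>k. degree (B k) = k" and monic: "\<And>k. coeff (B k) k = 1"
    and B1: "B 1 = monom 1 1"
    and \<alpha>: "\<alpha> > 1" "multiplier_sequence B (\<lambda>k. \<alpha> ^ k)"
             "multiplier_sequence B (\<lambda>k. (1 / \<alpha>) ^ k)"
  shows "B n = monom 1 n"
proof (induction n rule: less_induct)
  case (less n)
  consider "n = 0" | "n = 1" | m where "n = Suc (Suc m)"
    by (metis One_nat_def not0_implies_Suc)
  thus ?case
  proof cases
    case 1
    show ?thesis
    proof (rule poly_eqI)
      fix i show "coeff (B n) i = coeff (monom 1 n) i"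
        using monic[of 0] deg[of 0] 1 by (cases i) (auto simp: coeff_eq_0)
    qed
  next
    case 2
    thus ?thesis using B1 by simp
  next
    case (3 m)
    define e where "e = B n - monom 1 n"
    define G where "G = (\<lambda>\<beta>. \<Sum>j<n. monom (coeff e j * (1 - 1 / \<beta> ^ (n - j))) j)"
    have coeff_G: "coeff (G \<beta>) j = (if j < n then coeff e j * (1 - 1 / \<beta> ^ (n - j)) else 0)" for \<beta> j
      by (simp add: G_def coeff_sum_monom_lessThan)
    have coeff_B: "coeff (B n) j = (if j < n then coeff e j else if j = n then 1 else 0)" for j
      using deg[of n] monic[of n] by (auto simp: e_def coeff_eq_0)
    have real: "only_real_zeros ([:-s, 1:] ^ n + G \<beta>)"
      if \<beta>: "\<beta> > 0" "multiplier_sequence B (\<lambda>k. \<beta> ^ k)" for \<beta> s :: real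
    proof -
      \<comment> \<open>The coordinates of \<open>(x - s\<beta>)\<^sup>n\<close> in the basis \<open>B\<close>: the leading term uses \<open>b\<^sub>n\<close>, so its
        lower part \<open>e\<close> has to be subtracted again.\<close>
      define a where "a = (\<lambda>k. if k = n then 1 else coeff ([:-(s * \<beta>), 1:] ^ n) k - coeff e k)"
      have split: "(\<Sum>k\<le>n. smult (c k) (B k)) = (\<Sum>k<n. monom (c k) k) + smult (c n) (B n)" for c
        using less.IH by (simp add: lessThan_Suc_atMost[symmetric] smult_monom)
      have "(\<Sum>k\<le>n. smult (a k) (B k)) = [:-(s * \<beta>), 1:] ^ n"
        unfolding split
        by (rule poly_eqI)
           (auto simp: coeff_sum_monom_lessThan coeff_B a_def
                 coeff_linear_power coeff_eq_0 degree_linear_power)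
      moreover have "only_real_zeros ([:-(s * \<beta>), 1:] ^ n)"
        by (auto simp: only_real_zeros_def poly_of_real_power map_poly_pCons)
      ultimately have "only_real_zeros (\<Sum>k\<le>n. smult (a k * \<beta> ^ k) (B k))"
        using \<beta>(2) by (simp add: multiplier_sequence_def)
      also have "(\<Sum>k\<le>n. smult (a k * \<beta> ^ k) (B k)) = smult (\<beta> ^ n) ([:-s, 1:] ^ n + G \<beta>)"
      proof (rule poly_eqI)
        fix i
        show "coeff (\<Sum>k\<le>n. smult (a k * \<beta> ^ k) (B k)) i
                = coeff (smult (\<beta> ^ n) ([:-s, 1:] ^ n + G \<beta>)) i"
        proof (cases "i < n")
          case True
          hence "\<beta> ^ n = \<beta> ^ i * \<beta> ^ (n - i)" by (simp flip: power_add)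
          moreover have "(- (s * \<beta>)) ^ (n - i) = (-s) ^ (n - i) * \<beta> ^ (n - i)"
            by (simp flip: power_mult_distrib)
          ultimately show ?thesis
            unfolding split using True \<beta>(1)
            by (simp add: coeff_sum_monom_lessThan coeff_B coeff_G a_def
                  coeff_linear_poly_power field_simps)
        next
          case False
          thus ?thesis
            unfolding split
            by (simp add: coeff_sum_monom_lessThan coeff_B coeff_G a_def
                  coeff_linear_power coeff_eq_0 degree_linear_power)
        qed
      qed
      finally have "only_real_zeros (smult (1 / \<beta> ^ n) (smult (\<beta> ^ n) ([:-s, 1:] ^ n + G \<beta>)))"
        by (rule only_real_zeros_smult)
      thus ?thesis using \<beta>(1) by simp
    qed
    have deg_G: "degree (G \<beta>) < Suc (Suc m)" for \<beta>
      using 3 by (intro degree_lessI) (auto simp: coeff_G)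
    note real_up = real[OF _ \<alpha>(2), unfolded 3] and real_down = real[OF _ \<alpha>(3), unfolded 3]
    have "coeff (G \<alpha>) m \<le> 0" "coeff (G (1 / \<alpha>)) m \<le> 0"
      using perturbed_powers(1)[OF deg_G real_up] perturbed_powers(1)[OF deg_G real_down] \<alpha>(1)
      by auto
    hence "coeff e m * (1 - 1 / \<alpha>\<^sup>2) \<le> 0" "coeff e m * (1 - \<alpha>\<^sup>2) \<le> 0"
      using 3 by (auto simp: coeff_G power_divide power2_eq_square)
    moreover have "1 - 1 / \<alpha>\<^sup>2 > 0" "1 - \<alpha>\<^sup>2 < 0"
      using \<alpha>(1) by (auto simp: one_less_power)
    ultimately have "coeff e m = 0"
      by (simp add: mult_le_0_iff)
    hence "G \<alpha> = 0"
      using perturbed_powers(2)[OF deg_G real_up] \<alpha>(1) by (simp add: coeff_G)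
    have "coeff e j = 0" if "j < n" for j
    proof -
      have "\<alpha> ^ (n - j) > 1" using \<alpha>(1) that by (intro one_less_power) auto
      moreover have "coeff e j * (1 - 1 / \<alpha> ^ (n - j)) = 0"
        using coeff_G[of \<alpha> j] \<open>G \<alpha> = 0\<close> that by simp
      ultimately show ?thesis by auto
    qed
    thus ?thesis by (intro poly_eqI) (simp add: coeff_B)
  qed
qed

section \<open>From an arbitrary simple set to the monomials\<close>

lemma simple_set_expansion:
  assumes "simple_set q" "degree p \<le> k"
  shows   "\<exists>a. (\<forall>j>k. a j = 0) \<and> p = (\<Sum>j\<le>k. smult (a j) (q j))"
  using assms(2)
proof (induction k arbitrary: p)
  case 0
  have "degree (q 0) = 0" "q 0 \<noteq> 0" using assms(1) by (auto simp: simple_set_def)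
  then obtain c where c: "q 0 = [:c:]" "c \<noteq> 0" by (metis degree_eq_zeroE pCons_0_0)
  obtain d where "p = [:d:]" using 0 by (metis degree_eq_zeroE le_zero_eq)
  thus ?case using c by (intro exI[of _ "\<lambda>j. if j = 0 then d / c else 0"]) auto
next
  case (Suc k)
  define c where "c = coeff p (Suc k) / coeff (q (Suc k)) (Suc k)"
  have q: "degree (q (Suc k)) = Suc k" "coeff (q (Suc k)) (Suc k) \<noteq> 0"
    using assms(1) leading_coeff_neq_0[of "q (Suc k)"] unfolding simple_set_def by metis+
  have "degree (p - smult c (q (Suc k))) \<le> k"
  proof (rule degree_le, intro allI impI)
    fix i assume "i > k"
    thus "coeff (p - smult c (q (Suc k))) i = 0"
      using Suc.prems q by (cases "i = Suc k") (auto simp: c_def coeff_eq_0)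
  qed
  from Suc.IH[OF this] obtain a where a: "p - smult c (q (Suc k)) = (\<Sum>j\<le>k. smult (a j) (q j))"
    by blast
  have "p = (\<Sum>j\<le>k. smult (a j) (q j)) + smult c (q (Suc k))"
    by (simp flip: a)
  thus ?case
    by (intro exI[of _ "\<lambda>j. if j \<le> k then a j else if j = Suc k then c else 0"]) auto
qed

text \<open>
The polynomials \<open>C k\<close> are the images of \<open>x\<^sup>k\<close> under the linear operator with \<open>q\<^sub>k \<mapsto> \<gamma>\<^sub>k q\<^sub>k\<close>. The
operator does not raise degrees, and on leading terms it acts as \<open>\<gamma>\<^sub>k\<close>, since
\<open>x\<^sup>k\<close> is a multiple of \<open>q\<^sub>k\<close> up to lower order.
\<close>
lemma triangular_operator:
  assumes q: "simple_set q" and ms: "multiplier_sequence q \<gamma>"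
  shows "\<exists>C. (\<forall>k. degree (C k) \<le> k \<and> coeff (C k) k = \<gamma> k) \<and>
             (\<forall>n c. only_real_zeros (\<Sum>k\<le>n. monom (c k) k)
                \<longrightarrow> only_real_zeros (\<Sum>k\<le>n. smult (c k) (C k)))"
proof -
  have "\<forall>k. \<exists>a. (\<forall>j>k. a j = 0) \<and> monom 1 k = (\<Sum>j\<le>k. smult (a j) (q j))"
    using simple_set_expansion[OF q] by (auto simp: degree_monom_le)
  then obtain A where A0: "\<And>k j. j > k \<Longrightarrow> A k j = 0"
    and A: "\<And>k. monom 1 k = (\<Sum>j\<le>k. smult (A k j) (q j))"
    by metis
  define C where "C = (\<lambda>k. \<Sum>j\<le>k. smult (A k j * \<gamma> j) (q j))"
  have deg_q: "degree (q j) = j" for j using q by (simp add: simple_set_def)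
  have top: "coeff (\<Sum>j\<le>k. smult (f j) (q j)) k = f k * coeff (q k) k" for f :: "nat \<Rightarrow> real" and k
  proof -
    have "coeff (\<Sum>j\<le>k. smult (f j) (q j)) k
            = (\<Sum>j\<in>{..k}. if j = k then f k * coeff (q k) k else 0)"
      unfolding coeff_sum by (intro sum.cong refl) (auto simp: coeff_eq_0 deg_q)
    thus ?thesis by simp
  qed
  have "degree (C k) \<le> k" for k
    unfolding C_def
    by (intro degree_sum_le) (auto intro: order_trans[OF degree_smult_le] simp: deg_q)
  moreover have "coeff (C k) k = \<gamma> k" for k
  proof -
    have "A k k * coeff (q k) k = 1" using top[of "A k" k] by (simp flip: A)
    thus ?thesis using top[of "\<lambda>j. A k j * \<gamma> j" k] by (simp add: C_def mult.commute mult.left_commute)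
  qed
  moreover have "only_real_zeros (\<Sum>k\<le>n. smult (c k) (C k))"
    if c: "only_real_zeros (\<Sum>k\<le>n. monom (c k) k)" for n c
  proof -
    \<comment> \<open>The coordinates of \<open>\<Sum> c\<^sub>k x\<^sup>k\<close> in the basis \<open>q\<close>.\<close>
    define d where "d = (\<lambda>j. \<Sum>k\<le>n. c k * A k j)"
    have extend: "(\<Sum>j\<le>k. smult (A k j * f j) (q j)) = (\<Sum>j\<le>n. smult (A k j * f j) (q j))"
      if "k \<le> n" for k f
      using that by (intro sum.mono_neutral_left) (auto simp: A0)
    have regroup: "(\<Sum>k\<le>n. smult (c k) (\<Sum>j\<le>k. smult (A k j * f j) (q j)))
                     = (\<Sum>j\<le>n. smult (d j * f j) (q j))" for f
    proof -
      have "(\<Sum>k\<le>n. smult (c k) (\<Sum>j\<le>k. smult (A k j * f j) (q j)))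
              = (\<Sum>k\<le>n. \<Sum>j\<le>n. smult (c k * A k j * f j) (q j))"
        by (intro sum.cong refl) (simp add: extend smult_sum_right mult.assoc)
      also have "\<dots> = (\<Sum>j\<le>n. \<Sum>k\<le>n. smult (c k * A k j * f j) (q j))"
        by (rule sum.swap)
      also have "\<dots> = (\<Sum>j\<le>n. smult (d j * f j) (q j))"
        by (simp add: d_def smult_sum sum_distrib_right)
      finally show ?thesis .
    qed
    have "(\<Sum>k\<le>n. monom (c k) k) = (\<Sum>k\<le>n. smult (c k) (monom 1 k))"
      by (simp add: smult_monom)
    also have "\<dots> = (\<Sum>j\<le>n. smult (d j) (q j))"
      using regroup[of "\<lambda>_. 1"] by (simp add: A)
    finally have "only_real_zeros (\<Sum>j\<le>n. smult (d j * \<gamma> j) (q j))"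
      using ms c by (simp add: multiplier_sequence_def)
    thus ?thesis using regroup[of \<gamma>] by (simp add: C_def)
  qed
  ultimately show ?thesis by blast
qed

text \<open>
The coefficient of degree \<open>j\<close> picks up the factor \<open>\<epsilon>\<^sup>k\<^sup>-\<^sup>j\<close>, so only degree \<open>k\<close> survives.
\<close>
lemma rescaled_poly_tendsto:
  fixes \<epsilon> :: "nat \<Rightarrow> 'a :: real_normed_field"
  assumes "\<epsilon> \<longlonglongrightarrow> 0" "\<And>m. \<epsilon> m \<noteq> 0" "degree p \<le> k"
  shows   "(\<lambda>m. \<epsilon> m ^ k * poly p (z / \<epsilon> m)) \<longlonglongrightarrow> coeff p k * z ^ k"
  using assms(3)
proof (induction p arbitrary: k)
  case (pCons c p)
  show ?case
  proof (cases k)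
    case 0
    hence "p = 0" using pCons by (auto split: if_splits)
    thus ?thesis using 0 by simp
  next
    case (Suc l)
    have "degree p \<le> l" using pCons Suc by (auto split: if_splits)
    hence "(\<lambda>m. \<epsilon> m ^ Suc l * c + z * (\<epsilon> m ^ l * poly p (z / \<epsilon> m)))
             \<longlonglongrightarrow> 0 ^ Suc l * c + z * (coeff p l * z ^ l)"
      by (intro tendsto_intros assms(1) pCons.IH)
    also have "(\<lambda>m. \<epsilon> m ^ Suc l * c + z * (\<epsilon> m ^ l * poly p (z / \<epsilon> m)))
                 = (\<lambda>m. \<epsilon> m ^ k * poly (pCons c p) (z / \<epsilon> m))"
    proof
      fix m
      show "\<epsilon> m ^ Suc l * c + z * (\<epsilon> m ^ l * poly p (z / \<epsilon> m))
              = \<epsilon> m ^ k * poly (pCons c p) (z / \<epsilon> m)"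
        using assms(2)[of m] by (simp add: Suc field_simps)
    qed
    finally show ?thesis by (simp add: Suc mult_ac)
  qed
qed auto

lemma multiplier_sequence_monom:
  assumes "simple_set q" "multiplier_sequence q \<gamma>"
  shows   "multiplier_sequence (\<lambda>k. monom 1 k) \<gamma>"
  unfolding multiplier_sequence_def
proof (intro allI impI)
  fix n and a :: "nat \<Rightarrow> real"
  assume "only_real_zeros (\<Sum>k\<le>n. smult (a k) (monom 1 k))"
  hence real: "only_real_zeros (\<Sum>k\<le>n. monom (a k) k)" by (simp add: smult_monom)
  from triangular_operator[OF assms] obtain C where
    deg: "\<And>k. degree (C k) \<le> k" and top: "\<And>k. coeff (C k) k = \<gamma> k" and
    pres: "\<And>n c. only_real_zeros (\<Sum>k\<le>n. monom (c k) k) \<Longrightarrow>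
                    only_real_zeros (\<Sum>k\<le>n. smult (c k) (C k))"
    by blast
  define \<epsilon> where "\<epsilon> = (\<lambda>m. 1 / real (Suc m))"
  have \<epsilon>: "\<epsilon> m \<noteq> 0" for m by (simp add: \<epsilon>_def)
  have \<epsilon>_lim: "(\<lambda>m. complex_of_real (\<epsilon> m)) \<longlonglongrightarrow> 0"
    unfolding \<epsilon>_def using tendsto_of_real[OF LIMSEQ_Suc[OF lim_1_over_n], where ?'a = complex] by simp
  \<comment> \<open>Dilate by \<open>\<epsilon>\<close>, apply the operator, and dilate back: \<open>x\<^sup>k\<close> goes to \<open>\<epsilon>\<^sup>k C\<^sub>k(x/\<epsilon>)\<close>, which tends to \<open>\<gamma>\<^sub>k x\<^sup>k\<close>.\<close>
  define F where "F = (\<lambda>m. (\<Sum>k\<le>n. smult (a k * \<epsilon> m ^ k) (C k)) \<circ>\<^sub>p [:0, 1 / \<epsilon> m:])"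
  show "only_real_zeros (\<Sum>k\<le>n. smult (a k * \<gamma> k) (monom 1 k))"
  proof (rule only_real_zeros_limit)
    fix m
    have "only_real_zeros ((\<Sum>k\<le>n. monom (a k) k) \<circ>\<^sub>p [:0, \<epsilon> m:])"
      using real \<epsilon> by (rule only_real_zeros_pcompose_affine)
    also have "(\<Sum>k\<le>n. monom (a k) k) \<circ>\<^sub>p [:0, \<epsilon> m:] = (\<Sum>k\<le>n. monom (a k * \<epsilon> m ^ k) k)"
      by (rule poly_eqI) (simp add: coeff_sum coeff_pcompose_linear)
    finally have "only_real_zeros (\<Sum>k\<le>n. smult (a k * \<epsilon> m ^ k) (C k))" by (rule pres)
    thus "only_real_zeros (F m)"
      unfolding F_def using \<epsilon> by (intro only_real_zeros_pcompose_affine) auto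
  next
    fix z
    have "(\<lambda>m. \<Sum>k\<le>n. of_real (a k) * (of_real (\<epsilon> m) ^ k *
              poly (map_poly complex_of_real (C k)) (z / of_real (\<epsilon> m))))
            \<longlonglongrightarrow> (\<Sum>k\<le>n. of_real (a k) * (coeff (map_poly complex_of_real (C k)) k * z ^ k))"
      using \<epsilon> deg
      by (intro tendsto_sum tendsto_mult tendsto_const rescaled_poly_tendsto \<epsilon>_lim)
         (auto simp: degree_map_poly)
    thus "(\<lambda>m. poly (map_poly complex_of_real (F m)) z)
            \<longlonglongrightarrow> poly (map_poly complex_of_real (\<Sum>k\<le>n. smult (a k * \<gamma> k) (monom 1 k))) z"
      by (simp add: F_def poly_of_real_pcompose poly_of_real_sum poly_of_real_smult
            map_poly_pCons coeff_map_poly top smult_monom map_poly_monom poly_monom mult_ac)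
  qed
qed

section \<open>Change of basis and conclusion\<close>

lemma multiplier_sequence_smult:
  assumes "multiplier_sequence b \<gamma>"
  shows   "multiplier_sequence (\<lambda>k. smult (c k) (b k)) \<gamma>"
  unfolding multiplier_sequence_def
proof (intro allI impI)
  fix n and a :: "nat \<Rightarrow> real"
  assume "only_real_zeros (\<Sum>k\<le>n. smult (a k) (smult (c k) (b k)))"
  hence "only_real_zeros (\<Sum>k\<le>n. smult (a k * c k * \<gamma> k) (b k))"
    using assms by (simp add: multiplier_sequence_def)
  thus "only_real_zeros (\<Sum>k\<le>n. smult (a k * \<gamma> k) (smult (c k) (b k)))"
    by (simp add: mult_ac)
qed

lemma multiplier_sequence_translate:
  assumes "multiplier_sequence b \<gamma>"
  shows   "multiplier_sequence (\<lambda>k. b k \<circ>\<^sub>p [:s, 1:]) \<gamma>"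
  unfolding multiplier_sequence_def
proof (intro allI impI)
  fix n and a :: "nat \<Rightarrow> real"
  have translate: "(\<Sum>k\<le>n. smult (c k) (b k \<circ>\<^sub>p [:s, 1:])) = (\<Sum>k\<le>n. smult (c k) (b k)) \<circ>\<^sub>p [:s, 1:]" for c
    by (simp add: pcompose_sum pcompose_smult)
  assume "only_real_zeros (\<Sum>k\<le>n. smult (a k) (b k \<circ>\<^sub>p [:s, 1:]))"
  hence "only_real_zeros ((\<Sum>k\<le>n. smult (a k) (b k)) \<circ>\<^sub>p [:s, 1:] \<circ>\<^sub>p [:-s, 1:])"
    unfolding translate by (rule only_real_zeros_pcompose_affine) simp
  also have "(\<Sum>k\<le>n. smult (a k) (b k)) \<circ>\<^sub>p [:s, 1:] \<circ>\<^sub>p [:-s, 1:] = (\<Sum>k\<le>n. smult (a k) (b k))"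
    by (simp add: pcompose_pCons flip: pcompose_assoc)
  finally have "only_real_zeros (\<Sum>k\<le>n. smult (a k * \<gamma> k) (b k))"
    using assms by (simp add: multiplier_sequence_def)
  thus "only_real_zeros (\<Sum>k\<le>n. smult (a k * \<gamma> k) (b k \<circ>\<^sub>p [:s, 1:]))"
    unfolding translate by (rule only_real_zeros_pcompose_affine) simp
qed

theorem theorem2:
  fixes b q :: "nat \<Rightarrow> real poly"
  assumes "simple_set b" and "simple_set q"
    and "\<exists>\<alpha>::real. \<alpha> > 1 \<and> multiplier_sequence b (\<lambda>k. \<alpha> ^ k)
           \<and> multiplier_sequence b (\<lambda>k. (1 / \<alpha>) ^ k)"
  shows "\<forall>\<gamma>. multiplier_sequence q \<gamma> \<longrightarrow> multiplier_sequence b \<gamma>"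
proof (intro allI impI)
  fix \<gamma>
  assume \<gamma>: "multiplier_sequence q \<gamma>"
  obtain \<alpha> :: real where \<alpha>: "\<alpha> > 1" "multiplier_sequence b (\<lambda>k. \<alpha> ^ k)"
    "multiplier_sequence b (\<lambda>k. (1 / \<alpha>) ^ k)"
    using assms(3) by blast
  have deg: "degree (b k) = k" and lead: "lead_coeff (b k) \<noteq> 0" for k
    using assms(1) unfolding simple_set_def leading_coeff_0_iff by auto
  \<comment> \<open>The zero of \<open>b\<^sub>1\<close>; moving it to the origin makes the monic multiple of \<open>b\<^sub>1\<close> equal to \<open>x\<close>.\<close>
  define x0 where "x0 = - coeff (b 1) 0 / coeff (b 1) 1"
  define B where "B = (\<lambda>k. smult (1 / lead_coeff (b k)) (b k \<circ>\<^sub>p [:x0, 1:]))"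
  have deg_B: "degree (B k) = k" for k
    using lead[of k] by (simp add: B_def degree_pcompose deg)
  moreover have "coeff (B k) k = 1" for k
  proof -
    have "lead_coeff (B k) = 1"
      using lead[of k] unfolding B_def by (simp add: lead_coeff_comp)
    thus ?thesis by (simp only: deg_B)
  qed
  moreover have "B 1 = monom 1 1"
  proof -
    have "b 1 = [:coeff (b 1) 0, coeff (b 1) 1:]"
      by (rule poly_eqI) (auto simp: coeff_pCons coeff_eq_0 deg split: nat.split)
    hence "b 1 \<circ>\<^sub>p [:x0, 1:] = [:coeff (b 1) 0, coeff (b 1) 1:] \<circ>\<^sub>p [:x0, 1:]" by simp
    thus ?thesis using lead[of 1]
      by (simp add: B_def x0_def deg pcompose_pCons monom_altdef)
  qed
  moreover have "multiplier_sequence B (\<lambda>k. \<alpha> ^ k)" "multiplier_sequence B (\<lambda>k. (1 / \<alpha>) ^ k)"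
    unfolding B_def by (intro multiplier_sequence_smult multiplier_sequence_translate \<alpha>)+
  ultimately have B: "B k = monom 1 k" for k
    using dilations_force_powers[of B \<alpha> k] \<alpha>(1) by blast
  have "b = (\<lambda>k. smult (lead_coeff (b k)) (monom 1 k \<circ>\<^sub>p [:-x0, 1:]))"
  proof
    fix k
    have "smult (lead_coeff (b k)) (B k \<circ>\<^sub>p [:-x0, 1:]) = b k \<circ>\<^sub>p [:x0, 1:] \<circ>\<^sub>p [:-x0, 1:]"
      using lead[of k] by (simp add: B_def pcompose_smult)
    also have "\<dots> = b k" by (simp add: pcompose_pCons flip: pcompose_assoc)
    finally show "b k = smult (lead_coeff (b k)) (monom 1 k \<circ>\<^sub>p [:-x0, 1:])"
      by (simp add: B)
  qed
  moreover have "multiplier_sequence (\<lambda>k. smult (lead_coeff (b k)) (monom 1 k \<circ>\<^sub>p [:-x0, 1:])) \<gamma>"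
    by (intro multiplier_sequence_smult multiplier_sequence_translate
          multiplier_sequence_monom[OF assms(2) \<gamma>])
  ultimately show "multiplier_sequence b \<gamma>" by simp
qed

end
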